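(* Let $\rho\in\mathbb{R}$ and $\sigma>0$ be such that (1) there is no $x\in\Delta$ with $f(x)>\rho$, and (2) $f(x)+\sigma\lVert Ax-b\rVert^2>\rho$ for every $x\in\Delta^c$. Let $$Q=\begin{bmatrix}\alpha+\sigma b^\top b&\frac12(c-2\sigma A^\top b)^\top\\ \frac12(c-2\sigma A^\top b)&F+\sigma A^\top A\end{bmatrix},\qquad C=\operatorname{Diag}(Qe)-Q,$$ and let $z_{\mathrm{ub}}\in\mathbb{R}$ be an upper bound on the value of the max-cut problem $\max\{\bar x^\top C\bar x\mid\bar x\in\{-1,1\}^{n+1}\}$. If $z_{\mathrm{ub}}<e^\top Qe-\rho$, then $\Delta=\emptyset$, i.e. the problem $\min\{f(x)\mid Ax=b,\ x\in\{-1,1\}^n\}$ is infeasible.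
   Context: Let $\hat F\in\mathbb{R}^{n\times n}$ be symmetric, $\hat c\in\mathbb{R}^n$, $\hat A\in\mathbb{Z}^{m\times n}$, $\hat b\in\mathbb{Z}^m$. With $e$ the all-ones vector of appropriate dimension, let $F=\frac14\hat F$, $c=\frac12(\hat c+\hat Fe)$, $\alpha=\frac12\hat c^\top e+\frac14e^\top\hat Fe$, $A=\frac12\hat A$, $b=\hat b-\frac12\hat Ae$. Set $f(x)=x^\top Fx+c^\top x+\alpha$, $\Delta=\{x\in\{-1,1\}^n\mid Ax=b\}$ and $\Delta^c=\{x\in\{-1,1\}^n\mid Ax\neq b\}$. $\lVert\cdot\rVert$ is the Euclidean norm and $\operatorname{Diag}(v)$ is the diagonal matrix with diagonal $v$. In $Q e$ and $e^\top Qe$, $e\in\mathbb{R}^{n+1}$. *)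

theory Defs
  imports "HOL-Analysis.L2_Norm" "Jordan_Normal_Form.Matrix"
begin

definition ones_vec :: "nat \<Rightarrow> real vec" where
  "ones_vec n = vec n (\<lambda>_. 1)"

definition vec_euclid_norm :: "real vec \<Rightarrow> real" where
  "vec_euclid_norm v = L2_set (\<lambda>i. v $ i) {0..<dim_vec v}"

definition sign_vecs :: "nat \<Rightarrow> real vec set" where
  "sign_vecs n = {x \<in> carrier_vec n. \<forall>i<n. x $ i \<in> {-1, 1}}"

definition quad_fun :: "real mat \<Rightarrow> real vec \<Rightarrow> real \<Rightarrow> real vec \<Rightarrow> real" where
  "quad_fun F c \<alpha> x = x \<bullet> (F *\<^sub>v x) + c \<bullet> x + \<alpha>"

definition feas_set :: "nat \<Rightarrow> real mat \<Rightarrow> real vec \<Rightarrow> real vec set" where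
  "feas_set n A b = {x \<in> sign_vecs n. A *\<^sub>v x = b}"

definition infeas_set :: "nat \<Rightarrow> real mat \<Rightarrow> real vec \<Rightarrow> real vec set" where
  "infeas_set n A b = {x \<in> sign_vecs n. A *\<^sub>v x \<noteq> b}"

text \<open>The scalar entry of the block matrix comes first, so index \<open>0\<close> is the additional
  (homogenising) coordinate.\<close>

definition penalty_mat ::
  "real mat \<Rightarrow> real vec \<Rightarrow> real \<Rightarrow> real mat \<Rightarrow> real vec \<Rightarrow> real \<Rightarrow> real mat" where
  "penalty_mat F c \<alpha> A b \<sigma> =
     (let q = (1/2) \<cdot>\<^sub>v (c - (2 * \<sigma>) \<cdot>\<^sub>v (A\<^sup>T *\<^sub>v b)) in
      four_block_mat
        (mat 1 1 (\<lambda>_. \<alpha> + \<sigma> * (b \<bullet> b)))  (mat_of_row q)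
        (mat_of_cols (dim_vec q) [q])       (F + \<sigma> \<cdot>\<^sub>m (A\<^sup>T * A)))"

definition maxcut_mat :: "real mat \<Rightarrow> real mat" where
  "maxcut_mat Q =
     mat_diag (dim_row Q) (\<lambda>i. (Q *\<^sub>v ones_vec (dim_col Q)) $ i) - Q"

definition maxcut_value :: "nat \<Rightarrow> real mat \<Rightarrow> real" where
  "maxcut_value k C = Max ((\<lambda>x. x \<bullet> (C *\<^sub>v x)) ` sign_vecs k)"

text \<open>The following two facts show that the maximum above is attained.\<close>

lemma finite_sign_vecs: "finite (sign_vecs n)"
proof (rule finite_subset)
  show "sign_vecs n \<subseteq> vec_of_list ` {xs. set xs \<subseteq> {-1, 1} \<and> length xs = n}"
  proof
    fix x assume x: "x \<in> sign_vecs n"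
    then have "set (list_of_vec x) \<subseteq> {-1, 1}" "length (list_of_vec x) = n"
      by (auto simp: sign_vecs_def set_list_of_vec vec_set_def)
    then show "x \<in> vec_of_list ` {xs. set xs \<subseteq> {-1, 1} \<and> length xs = n}"
      by (intro image_eqI[of _ _ "list_of_vec x"]) (auto simp: vec_list)
  qed
  show "finite (vec_of_list ` {xs. set xs \<subseteq> {-1, 1 :: real} \<and> length xs = n})"
    by (intro finite_imageI finite_lists_length_eq) simp
qed

lemma sign_vecs_nonempty: "sign_vecs n \<noteq> {}"
proof -
  have "ones_vec n \<in> sign_vecs n"
    by (simp add: sign_vecs_def ones_vec_def)
  then show ?thesis by blast
qed

end

theory Submission
  imports Defs
begin

text \<open>Homogenising with the coordinate \<open>y = (1, x)\<close> turns the penalised objective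
  \<open>f x + \<sigma> * \<parallel>A x - b\<parallel>\<^sup>2\<close> into \<open>y \<bullet> Q y\<close>, and since \<open>y\<^sub>i\<^sup>2 = 1\<close>
  on sign vectors, the cut value of \<open>y\<close> is \<open>e \<bullet> Q e - y \<bullet> Q y\<close>.  A feasible
  \<open>x\<close> has no penalty and \<open>f x \<le> \<rho>\<close>, so its cut value is at least
  \<open>e \<bullet> Q e - \<rho> > z_ub\<close>, which is impossible.\<close>

lemma mat_diag_mult_vec:
  assumes "v \<in> carrier_vec n"
  shows "mat_diag n d *\<^sub>v v = vec n (\<lambda>i. d i * v $ i)"
proof (rule eq_vecI)
  fix i assume "i < dim_vec (vec n (\<lambda>i. d i * v $ i))"
  then have i: "i < n" by simp
  \<comment> \<open>Moving the factor into the conditional gives the Kronecker delta form, in which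
    the sum collapses to its single term \<open>j = i\<close>.\<close>
  have "(\<Sum>j\<in>{0..<n}. (if i = j then d j else 0) * v $ j)
      = (\<Sum>j\<in>{0..<n}. if i = j then d j * v $ j else 0)"
    by (rule sum.cong) auto
  then show "(mat_diag n d *\<^sub>v v) $ i = vec n (\<lambda>i. d i * v $ i) $ i"
    using assms i by (simp add: mat_diag_def scalar_prod_def)
qed (simp add: mat_diag_def)

lemma smult_mat_mult_vec:
  fixes a :: "'a :: comm_semiring_0"
  assumes "M \<in> carrier_mat nr nc" "v \<in> carrier_vec nc"
  shows "(a \<cdot>\<^sub>m M) *\<^sub>v v = a \<cdot>\<^sub>v (M *\<^sub>v v)"
  using assms by (intro eq_vecI) auto

text \<open>The diagonal part weights each \<open>y $ i * y $ i\<close> by a row sum of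
  \<open>Q\<close>. These squares are all 1, so it contributes the same constant for every sign
  vector, and only the part from \<open>- Q\<close> varies with \<open>y\<close>.\<close>

lemma maxcut_mat_quadratic_form:
  assumes Q: "Q \<in> carrier_mat k k" and y: "y \<in> sign_vecs k"
  shows "y \<bullet> (maxcut_mat Q *\<^sub>v y) = ones_vec k \<bullet> (Q *\<^sub>v ones_vec k) - y \<bullet> (Q *\<^sub>v y)"
proof -
  let ?D = "mat_diag k (\<lambda>i. (Q *\<^sub>v ones_vec k) $ i)"
  have sq: "y $ i * y $ i = 1" if "i < k" for i
    using y that by (auto simp: sign_vecs_def)
  have yc: "y \<in> carrier_vec k"
    using y by (simp add: sign_vecs_def)
  have D: "?D \<in> carrier_mat k k"
    by (simp add: mat_diag_def)
  have "y \<bullet> (?D *\<^sub>v y) = (\<Sum>i\<in>{0..<k}. (Q *\<^sub>v ones_vec k) $ i * (y $ i * y $ i))"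
    using yc by (simp add: mat_diag_mult_vec[OF yc] scalar_prod_def mult_ac)
  also have "\<dots> = ones_vec k \<bullet> (Q *\<^sub>v ones_vec k)"
    using Q sq by (simp add: scalar_prod_def ones_vec_def)
  finally have "y \<bullet> (?D *\<^sub>v y) = ones_vec k \<bullet> (Q *\<^sub>v ones_vec k)" .
  moreover have "maxcut_mat Q *\<^sub>v y = ?D *\<^sub>v y - Q *\<^sub>v y"
    using Q by (simp add: maxcut_mat_def minus_mult_distrib_mat_vec[OF D Q yc])
  ultimately show ?thesis
    using D Q yc by (simp add: scalar_prod_minus_distrib[OF yc mult_mat_vec_carrier[OF D yc]
          mult_mat_vec_carrier[OF Q yc]])
qed

lemma penalty_mat_carrier:
  assumes "F \<in> carrier_mat n n" "c \<in> carrier_vec n" "A \<in> carrier_mat m n"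
  shows "penalty_mat F c \<alpha> A b \<sigma> \<in> carrier_mat (n + 1) (n + 1)"
  using assms by (auto simp: penalty_mat_def Let_def)

text \<open>The blocks of the matrix are the coefficients of the expanded penalised objective: the
  corner holds the constants, the two off-diagonal blocks each hold half of the linear part, and the
  last block holds the quadratic part. The leading 1 in \<open>y\<close> picks them out.\<close>

lemma penalty_mat_quadratic_form:
  assumes F: "F \<in> carrier_mat n n" and c: "c \<in> carrier_vec n"
    and A: "A \<in> carrier_mat m n" and b: "b \<in> carrier_vec m" and x: "x \<in> carrier_vec n"
  defines "y \<equiv> vec 1 (\<lambda>_. 1) @\<^sub>v x"
  shows "y \<bullet> (penalty_mat F c \<alpha> A b \<sigma> *\<^sub>v y)
    = quad_fun F c \<alpha> x + \<sigma> * ((A *\<^sub>v x - b) \<bullet> (A *\<^sub>v x - b))"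
proof -
  define u :: "real vec" where "u = vec 1 (\<lambda>_. 1)"
  define q where "q = (1/2) \<cdot>\<^sub>v (c - (2 * \<sigma>) \<cdot>\<^sub>v (A\<^sup>T *\<^sub>v b))"
  define s where "s = mat 1 1 (\<lambda>_. \<alpha> + \<sigma> * (b \<bullet> b))"
  define G where "G = F + \<sigma> \<cdot>\<^sub>m (A\<^sup>T * A)"
  have u: "u \<in> carrier_vec 1" and q: "q \<in> carrier_vec n" and s: "s \<in> carrier_mat 1 1"
    and G: "G \<in> carrier_mat n n" and Atb: "A\<^sup>T *\<^sub>v b \<in> carrier_vec n"
    and Ax: "A *\<^sub>v x \<in> carrier_vec m"
    using assms by (auto simp: u_def q_def s_def G_def)
  have yu: "y = u @\<^sub>v x"
    by (simp add: y_def u_def)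
  have qc: "mat_of_cols n [q] \<in> carrier_mat n 1"
    using mat_of_cols_carrier(1)[of n "[q]"] by simp
  have row: "mat_of_row q *\<^sub>v x = vec 1 (\<lambda>_. q \<bullet> x)"
    using q x by (intro eq_vecI) (auto simp: mat_of_row_def scalar_prod_def)
  have col: "mat_of_cols n [q] *\<^sub>v u = q"
    using q by (intro eq_vecI) (auto simp: u_def scalar_prod_def mat_of_cols_def)
  have "penalty_mat F c \<alpha> A b \<sigma> *\<^sub>v y
      = (s *\<^sub>v u + mat_of_row q *\<^sub>v x) @\<^sub>v (mat_of_cols n [q] *\<^sub>v u + G *\<^sub>v x)"
    using four_block_mat_mult_vec[OF s mat_of_row_carrier(1)[OF q] qc G u x] q
    by (simp add: penalty_mat_def yu s_def G_def Let_def flip: q_def)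
  then have "y \<bullet> (penalty_mat F c \<alpha> A b \<sigma> *\<^sub>v y)
      = u \<bullet> (s *\<^sub>v u + vec 1 (\<lambda>_. q \<bullet> x)) + x \<bullet> (q + G *\<^sub>v x)"
    using scalar_prod_append[OF u x, of "s *\<^sub>v u + vec 1 (\<lambda>_. q \<bullet> x)" "q + G *\<^sub>v x"] s u q G x
    by (simp add: yu row col)
  also have "u \<bullet> (s *\<^sub>v u + vec 1 (\<lambda>_. q \<bullet> x)) = \<alpha> + \<sigma> * (b \<bullet> b) + q \<bullet> x"
    by (simp add: u_def s_def scalar_prod_def)
  also have "x \<bullet> (q + G *\<^sub>v x) = q \<bullet> x + x \<bullet> (G *\<^sub>v x)"
    using q G x by (simp add: scalar_prod_add_distrib[of _ n] comm_scalar_prod[of x n q])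
  also have "x \<bullet> (G *\<^sub>v x) = x \<bullet> (F *\<^sub>v x) + \<sigma> * ((A *\<^sub>v x) \<bullet> (A *\<^sub>v x))"
  proof -
    have "G *\<^sub>v x = F *\<^sub>v x + \<sigma> \<cdot>\<^sub>v (A\<^sup>T *\<^sub>v (A *\<^sub>v x))"
      using F A x by (simp add: G_def add_mult_distrib_mat_vec[of _ n n]
          assoc_mult_mat_vec[of _ n m _ n] smult_mat_mult_vec[of _ n n])
    \<comment> \<open>Adjointness moves the transpose onto the left factor, so the Gram matrix
      yields the square of \<open>A *\<^sub>v x\<close>.\<close>
    moreover have "x \<bullet> (A\<^sup>T *\<^sub>v (A *\<^sub>v x)) = (A *\<^sub>v x) \<bullet> (A *\<^sub>v x)"
      using A x transpose_vec_mult_scalar[OF A x Ax]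
      by (simp add: comm_scalar_prod[of x n])
    ultimately show ?thesis
      using F A x by (simp add: scalar_prod_add_distrib[of _ n])
  qed
  \<comment> \<open>Both off-diagonal blocks contribute \<open>q \<bullet> x\<close>. Since
    \<open>quad_fun\<close> absorbs one \<open>c \<bullet> x\<close>, the bracketed difference is
    exactly the cross term of the penalty.\<close>
  finally have "y \<bullet> (penalty_mat F c \<alpha> A b \<sigma> *\<^sub>v y)
      = quad_fun F c \<alpha> x + \<sigma> * (b \<bullet> b) + (2 * (q \<bullet> x) - c \<bullet> x) + \<sigma> * ((A *\<^sub>v x) \<bullet> (A *\<^sub>v x))"
    by (simp add: quad_fun_def)
  moreover have "2 * (q \<bullet> x) = c \<bullet> x - 2 * \<sigma> * (b \<bullet> (A *\<^sub>v x))"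
    using A c Atb x transpose_vec_mult_scalar[OF A x b]
    by (simp add: q_def minus_scalar_prod_distrib[of _ n])
  moreover have "(A *\<^sub>v x - b) \<bullet> (A *\<^sub>v x - b)
      = (A *\<^sub>v x) \<bullet> (A *\<^sub>v x) - 2 * (b \<bullet> (A *\<^sub>v x)) + b \<bullet> b"
    using Ax b by (simp add: minus_scalar_prod_distrib[of _ m] scalar_prod_minus_distrib[of _ m]
        comm_scalar_prod[of "A *\<^sub>v x" m b])
  ultimately show ?thesis
    \<comment> \<open>After substitution of the three identities, the claim is polynomial arithmetic
      with the scalar products as atoms.\<close>
    by (simp only:) (simp add: algebra_simps)
qed

lemma maxcut_value_ge:
  "y \<in> sign_vecs k \<Longrightarrow> y \<bullet> (C *\<^sub>v y) \<le> maxcut_value k C"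
  by (simp add: maxcut_value_def finite_sign_vecs)

theorem proposition13:
  fixes n m :: nat
    and F_hat F A Q C :: "real mat"
    and c_hat c b :: "real vec"
    and A_hat :: "int mat"
    and b_hat :: "int vec"
    and \<alpha> \<rho> \<sigma> z_ub :: real
    and f :: "real vec \<Rightarrow> real"
    and \<Delta> \<Delta>c :: "real vec set"
  assumes "F_hat \<in> carrier_mat n n"
    and "F_hat\<^sup>T = F_hat"
    and "c_hat \<in> carrier_vec n"
    and "A_hat \<in> carrier_mat m n"
    and "b_hat \<in> carrier_vec m"
    and "F = (1/4) \<cdot>\<^sub>m F_hat"
    and "c = (1/2) \<cdot>\<^sub>v (c_hat + F_hat *\<^sub>v ones_vec n)"
    and "\<alpha> = (1/2) * (c_hat \<bullet> ones_vec n) + (1/4) * (ones_vec n \<bullet> (F_hat *\<^sub>v ones_vec n))"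
    and "A = (1/2) \<cdot>\<^sub>m map_mat real_of_int A_hat"
    and "b = map_vec real_of_int b_hat - (1/2) \<cdot>\<^sub>v (map_mat real_of_int A_hat *\<^sub>v ones_vec n)"
    and "f = quad_fun F c \<alpha>"
    and "\<Delta> = feas_set n A b"
    and "\<Delta>c = infeas_set n A b"
    and "\<sigma> > 0"
    and "\<not> (\<exists>x\<in>\<Delta>. f x > \<rho>)"
    and "\<forall>x\<in>\<Delta>c. f x + \<sigma> * (vec_euclid_norm (A *\<^sub>v x - b))\<^sup>2 > \<rho>"
    and "Q = penalty_mat F c \<alpha> A b \<sigma>"
    and "C = maxcut_mat Q"
    and "maxcut_value (n + 1) C \<le> z_ub"
    and "z_ub < ones_vec (n + 1) \<bullet> (Q *\<^sub>v ones_vec (n + 1)) - \<rho>"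
  shows "\<Delta> = {}"
proof (rule ccontr)
  assume "\<Delta> \<noteq> {}"
  then obtain x where x\<Delta>: "x \<in> \<Delta>" by blast
  then have xs: "x \<in> sign_vecs n" and Axb: "A *\<^sub>v x = b"
    using assms(12) by (auto simp: feas_set_def)
  have F: "F \<in> carrier_mat n n" and c: "c \<in> carrier_vec n"
    and A: "A \<in> carrier_mat m n" and b: "b \<in> carrier_vec m" and x: "x \<in> carrier_vec n"
    using assms(1,3-7,9,10) xs by (auto simp: ones_vec_def sign_vecs_def)
  define y where "y = vec 1 (\<lambda>_. 1) @\<^sub>v x"
  have y: "y \<in> sign_vecs (n + 1)"
    \<comment> \<open>Index 0 is the added entry 1; every other index is a shifted index of
      \<open>x\<close>.\<close>
    using xs by (auto simp: y_def sign_vecs_def append_vec_def Let_def less_Suc_eq_0_disj)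
  have Q: "Q \<in> carrier_mat (n + 1) (n + 1)"
    using penalty_mat_carrier[OF F c A] assms(17) by simp
  \<comment> \<open>Feasibility makes the residual \<open>b - b\<close>, so the penalty vanishes
    whatever the value of \<sigma>.\<close>
  have "y \<bullet> (Q *\<^sub>v y) = f x"
    using penalty_mat_quadratic_form[OF F c A b x] b assms(11,17) by (simp add: y_def Axb)
  moreover have "f x \<le> \<rho>"
    using assms(15) x\<Delta> by force
  moreover have "y \<bullet> (C *\<^sub>v y) \<le> z_ub"
    using maxcut_value_ge[OF y] assms(19) by (rule order_trans)
  ultimately show False
    using maxcut_mat_quadratic_form[OF Q y] assms(18,20) by simp
qed

end
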